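(* We have $\overline{\sigma_o\mathrm{mex}}(0)=1$. Moreover, for all integers $n\ge 1$, $$\overline{\sigma_o\mathrm{mex}}(n)\equiv 0\pmod 4\quad\text{if and only if}\quad n\text{ is a perfect square}.$$
   Context: An overpartition of a nonnegative integer $n$ is a non-increasing sequence of positive integers summing to $n$ in which the first occurrence of each distinct integer may (or may not) be overlined; $\overline{\mathcal P}(n)$ denotes the set of all overpartitions of $n$ (the only overpartition of $0$ is the empty one). For an overpartition $\lambda$, $\mathrm{mex}(\lambda)$ is the least positive integer that does not occur as a part of $\lambda$, where a value counts as occurring whether it appears overlined or non-overlined. Put $\mathrm{mex}_o(\lambda)=\mathrm{mex}(\lambda)$ if $\mathrm{mex}(\lambda)$ is odd and $\mathrm{mex}_o(\lambda)=0$ otherwise. Define $\overline{\sigma_o\mathrm{mex}}(n)=\sum_{\lambda\in\overline{\mathcal P}(n)}\mathrm{mex}_o(\lambda)$ for $n\ge 0$. *)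

theory Defs
  imports "HOL-Number_Theory.Cong" "HOL-Computational_Algebra.Nth_Powers"
begin

text \<open>
  A part is a pair of its value and a flag that is \<open>True\<close> iff the part is overlined.
  The last condition lets only the first occurrence of a value be overlined.
\<close>

definition is_overpartition :: "(nat \<times> bool) list \<Rightarrow> bool" where
  "is_overpartition xs \<longleftrightarrow>
     sorted_wrt (\<ge>) (map fst xs) \<and>
     (\<forall>k \<in> set (map fst xs). k > 0) \<and>
     (\<forall>i < length xs. snd (xs ! i) \<longrightarrow> (\<forall>j < i. fst (xs ! j) \<noteq> fst (xs ! i)))"

definition overpartitions :: "nat \<Rightarrow> (nat \<times> bool) list set" where
  "overpartitions n = {xs. is_overpartition xs \<and> sum_list (map fst xs) = n}"

definition mex :: "(nat \<times> bool) list \<Rightarrow> nat" where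
  "mex xs = (LEAST k. k > 0 \<and> k \<notin> set (map fst xs))"

definition mex_odd :: "(nat \<times> bool) list \<Rightarrow> nat" where
  "mex_odd xs = (if odd (mex xs) then mex xs else 0)"

definition sigma_odd_mex :: "nat \<Rightarrow> nat" where
  "sigma_odd_mex n = (\<Sum>xs \<in> overpartitions n. mex_odd xs)"

text \<open>Finiteness, so that the sum above is a genuine finite sum.\<close>

lemma finite_overpartitions: "finite (overpartitions n)"
proof (rule finite_subset)
  let ?A = "{..n} \<times> (UNIV :: bool set)"
  show "finite {xs. set xs \<subseteq> ?A \<and> length xs \<le> n}"
    by (rule finite_lists_length_le) auto
  have len: "length ys \<le> sum_list ys" if "\<forall>k \<in> set ys. k > 0" for ys :: "nat list"
    using that by (induction ys) auto
  show "overpartitions n \<subseteq> {xs. set xs \<subseteq> ?A \<and> length xs \<le> n}"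
  proof (rule subsetI)
    fix xs assume xs: "xs \<in> overpartitions n"
    then have s: "sum_list (map fst xs) = n" and p: "\<forall>k \<in> set (map fst xs). k > 0"
      by (auto simp: overpartitions_def is_overpartition_def)
    have "length xs \<le> n"
      using len[OF p] s by simp
    moreover have "fst x \<le> n" if "x \<in> set xs" for x
      using member_le_sum_list[of "fst x" "map fst xs"] s that by auto
    ultimately show "xs \<in> {xs. set xs \<subseteq> ?A \<and> length xs \<le> n}"
      by auto
  qed
qed

end

theory Submission
  imports Defs
begin

text \<open>
  Forgetting the overlines sends an overpartition of \<open>n\<close> to an ordinary partition of \<open>n\<close> and
  does not change the mex. A partition with \<open>d\<close> distinct part sizes arises from exactly \<open>2 ^ d\<close>
  overpartitions, since each size may or may not have its first occurrence overlined
  (\<open>card_overlinings\<close>). Hence the sum of odd mexes is the sum of \<open>2 ^ d\<close> times the odd mex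
  over the ordinary partitions of \<open>n\<close> (\<open>sigma_odd_mex_eq_sum_partitions\<close>), and modulo 4 only
  partitions with \<open>d \<le> 1\<close> matter.

  For \<open>n \<ge> 1\<close> these are the partitions into \<open>n div k\<close> copies of a divisor \<open>k\<close> of \<open>n\<close>. If
  \<open>k = 1\<close>, the mex is 2 and nothing is contributed; if \<open>k > 1\<close>, the mex is 1 and the contribution
  is 2. So the sum is congruent to twice the number of divisors of \<open>n\<close> other than 1, and it
  vanishes modulo 4 exactly when the number of all divisors is odd. Pairing \<open>k\<close> with \<open>n div k\<close>
  shows that this happens exactly for the perfect squares (\<open>odd_card_divisors_iff_square\<close>).
\<close>

definition partitions :: "nat \<Rightarrow> nat list set" where
  "partitions n = {ys. sorted_wrt (\<ge>) ys \<and> (\<forall>k \<in> set ys. k > 0) \<and> sum_list ys = n}"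

definition overlinings :: "nat list \<Rightarrow> (nat \<times> bool) list set" where
  "overlinings ys = {xs. is_overpartition xs \<and> map fst xs = ys}"

definition mex_odd_parts :: "nat list \<Rightarrow> nat" where
  "mex_odd_parts ys =
     (let m = (LEAST k. k > 0 \<and> k \<notin> set ys) in if odd m then m else 0)"

lemma mex_odd_eq: "mex_odd xs = mex_odd_parts (map fst xs)"
  by (simp add: mex_odd_def mex_def mex_odd_parts_def)

text \<open>
  An overlining is determined by the set of values that carry an overline, because the overline
  can only sit on the first occurrence; and every set of values occurring in the list is possible.
\<close>

lemma card_overlinings:
  assumes sorted: "sorted_wrt (\<ge>) ys" and pos: "\<forall>k \<in> set ys. k > 0"
  shows "card (overlinings ys) = 2 ^ card (set ys)"
proof -
  define marked where "marked xs = {k. (k, True) \<in> set xs}" for xs :: "(nat \<times> bool) list"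
  define mark where "mark S =
    map (\<lambda>i. (ys ! i, ys ! i \<in> S \<and> (\<forall>j<i. ys ! j \<noteq> ys ! i))) [0..<length ys]" for S
  have fst_mark: "map fst (mark S) = ys" for S
    by (simp add: mark_def comp_def map_nth)
  have "bij_betw marked (overlinings ys) (Pow (set ys))"
  proof (rule bij_betw_byWitness[where f' = mark])
    show "\<forall>xs \<in> overlinings ys. mark (marked xs) = xs"
    proof
      fix xs assume "xs \<in> overlinings ys"
      then have ys: "ys = map fst xs"
        and first: "\<And>i j. i < length xs \<Longrightarrow> snd (xs ! i) \<Longrightarrow> j < i \<Longrightarrow> fst (xs ! j) \<noteq> fst (xs ! i)"
        by (auto simp: overlinings_def is_overpartition_def)
      show "mark (marked xs) = xs"
      proof (rule nth_equalityI)
        show "length (mark (marked xs)) = length xs"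
          by (simp add: mark_def ys)
      next
        fix i assume "i < length (mark (marked xs))"
        then have i: "i < length xs" by (simp add: mark_def ys)
        have "snd (xs ! i)"
          if "(fst (xs ! i), True) \<in> set xs" and new: "\<forall>j<i. fst (xs ! j) \<noteq> fst (xs ! i)"
        proof -
          from that(1) obtain j where j: "j < length xs" "xs ! j = (fst (xs ! i), True)"
            by (metis in_set_conv_nth)
          have "\<not> j < i" using new j(2) by auto
          moreover have "\<not> i < j" using first[OF j(1), of i] j(2) by auto
          ultimately have "i = j" by simp
          then show ?thesis using j(2) by (metis snd_conv)
        qed
        moreover have "(fst (xs ! i), True) \<in> set xs" if "snd (xs ! i)"
          using i that by (metis nth_mem prod.collapse)
        ultimately have "snd (xs ! i) \<longleftrightarrow>
            fst (xs ! i) \<in> marked xs \<and> (\<forall>j<i. fst (xs ! j) \<noteq> fst (xs ! i))"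
          using first[OF i] by (auto simp: marked_def)
        then show "mark (marked xs) ! i = xs ! i"
          using i by (auto simp: mark_def ys prod_eq_iff)
      qed
    qed
    show "\<forall>S \<in> Pow (set ys). marked (mark S) = S"
    proof
      fix S assume S: "S \<in> Pow (set ys)"
      have "k \<in> marked (mark S)" if "k \<in> S" for k
      proof -
        \<comment> \<open>the overline for \<open>k\<close> goes to the first position where \<open>k\<close> occurs\<close>
        define i where "i = (LEAST i. i < length ys \<and> ys ! i = k)"
        from S that have "\<exists>i. i < length ys \<and> ys ! i = k"
          by (auto simp: in_set_conv_nth)
        then have i: "i < length ys \<and> ys ! i = k"
          unfolding i_def by (rule LeastI_ex)
        moreover have "ys ! j \<noteq> k" if "j < i" for j
          using not_less_Least[OF that[unfolded i_def]] i that by auto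
        ultimately show ?thesis
          using that by (auto simp: marked_def mark_def image_iff intro!: bexI[of _ i])
      qed
      moreover have "marked (mark S) \<subseteq> S"
        by (auto simp: marked_def mark_def)
      ultimately show "marked (mark S) = S" by blast
    qed
    show "marked ` overlinings ys \<subseteq> Pow (set ys)"
      by (force simp: marked_def overlinings_def)
    show "mark ` Pow (set ys) \<subseteq> overlinings ys"
    proof -
      have "mark S \<in> overlinings ys" for S
        unfolding overlinings_def is_overpartition_def mem_Collect_eq fst_mark
        using sorted pos by (auto simp: mark_def)
      then show ?thesis by blast
    qed
  qed
  then show ?thesis
    by (simp add: bij_betw_same_card card_Pow)
qed

lemma map_fst_overpartition:
  "xs \<in> overpartitions n \<Longrightarrow> map fst xs \<in> partitions n"
  by (simp add: overpartitions_def partitions_def is_overpartition_def)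

lemma overpartitions_eq_UN_overlinings:
  "overpartitions n = (\<Union>ys \<in> partitions n. overlinings ys)"
  using map_fst_overpartition
  by (auto simp: overpartitions_def overlinings_def partitions_def)

lemma finite_overlinings: "finite (overlinings ys)"
  by (rule finite_subset[OF _ finite_overpartitions[of "sum_list ys"]])
     (auto simp: overlinings_def overpartitions_def)

lemma finite_partitions: "finite (partitions n)"
proof -
  have "ys \<in> map fst ` overpartitions n" if "ys \<in> partitions n" for ys
  proof -
    have "card (overlinings ys) \<noteq> 0"
      using that by (simp add: partitions_def card_overlinings)
    then obtain xs where "xs \<in> overlinings ys" by fastforce
    then show ?thesis
      using that by (auto simp: overlinings_def overpartitions_def partitions_def)
  qed
  then show ?thesis
    by (meson finite_imageI finite_overpartitions finite_subset subsetI)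
qed

lemma sigma_odd_mex_eq_sum_partitions:
  "sigma_odd_mex n = (\<Sum>ys \<in> partitions n. 2 ^ card (set ys) * mex_odd_parts ys)"
proof -
  have "sigma_odd_mex n = (\<Sum>ys \<in> partitions n. \<Sum>xs \<in> overlinings ys. mex_odd xs)"
    unfolding sigma_odd_mex_def overpartitions_eq_UN_overlinings
    by (rule sum.UNION_disjoint)
       (auto simp: finite_partitions finite_overlinings, auto simp: overlinings_def)
  also have "\<dots> = (\<Sum>ys \<in> partitions n. 2 ^ card (set ys) * mex_odd_parts ys)"
  proof (rule sum.cong[OF refl])
    fix ys assume ys: "ys \<in> partitions n"
    have "(\<Sum>xs \<in> overlinings ys. mex_odd xs) = (\<Sum>xs \<in> overlinings ys. mex_odd_parts ys)"
      by (rule sum.cong) (auto simp: mex_odd_eq overlinings_def)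
    also have "\<dots> = 2 ^ card (set ys) * mex_odd_parts ys"
      using ys by (simp add: card_overlinings partitions_def)
    finally show "(\<Sum>xs \<in> overlinings ys. mex_odd xs) = 2 ^ card (set ys) * mex_odd_parts ys" .
  qed
  finally show ?thesis .
qed

lemma mex_odd_parts_singleton:
  assumes "set ys = {k}" "k > 0"
  shows "mex_odd_parts ys = (if k = 1 then 0 else 1)"
proof -
  have "(LEAST j. j > 0 \<and> j \<noteq> k) = (if k = 1 then 2 else 1)"
    by (rule Least_equality) (use assms(2) in auto)
  then show ?thesis
    by (simp add: mex_odd_parts_def assms(1))
qed

text \<open>
  The divisors of \<open>n\<close> enter here: a partition with only one part size \<open>k\<close> consists of \<open>m\<close>
  copies of \<open>k\<close> with \<open>m * k = n\<close>. Positivity of \<open>n\<close> makes the multiplicity nonzero, so that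
  the size can be read off as the head of the list.
\<close>

lemma bij_betw_divisors_one_size_partitions:
  assumes "n > 0"
  shows "bij_betw (\<lambda>k. replicate (n div k) k) {k. k dvd n}
           {ys \<in> partitions n. card (set ys) = 1}"
proof (rule bij_betw_byWitness[where f' = hd])
  have pos: "n div k > 0 \<and> k > 0" if "k dvd n" for k
    using assms that by (auto elim!: dvdE)
  then show "\<forall>k \<in> {k. k dvd n}. hd (replicate (n div k) k) = k"
    by auto
  have single: "set ys = {hd ys} \<and> ys = replicate (length ys) (hd ys) \<and> length ys * hd ys = n"
    if "ys \<in> partitions n" "card (set ys) = 1" for ys
  proof -
    from that(2) obtain k where k: "set ys = {k}"
      by (auto simp: card_1_singleton_iff)
    then have hd: "hd ys = k"
      by (metis hd_in_set list.set(1) singletonD insert_not_empty)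
    have rep: "ys = replicate (length ys) k"
      by (rule replicate_eqI) (use k in auto)
    have "n = sum_list ys"
      using that(1) by (simp add: partitions_def)
    also have "\<dots> = length ys * k"
      by (subst rep) (simp add: sum_list_replicate)
    finally show ?thesis
      using k rep unfolding hd by blast
  qed
  show "\<forall>ys \<in> {ys \<in> partitions n. card (set ys) = 1}. replicate (n div hd ys) (hd ys) = ys"
  proof clarify
    fix ys assume ys: "ys \<in> partitions n" "card (set ys) = 1"
    from single[OF this] have "length ys * hd ys = n" "ys = replicate (length ys) (hd ys)"
      by auto
    moreover from this assms have "hd ys > 0" by (metis mult_0_right gr0I)
    ultimately show "replicate (n div hd ys) (hd ys) = ys"
      by (metis div_mult_self_is_m)
  qed
  show "(\<lambda>k. replicate (n div k) k) ` {k. k dvd n} \<subseteq> {ys \<in> partitions n. card (set ys) = 1}"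
    using pos by (auto simp: partitions_def sum_list_replicate sorted_wrt_iff_nth_less)
  show "hd ` {ys \<in> partitions n. card (set ys) = 1} \<subseteq> {k. k dvd n}"
    using single by (auto intro: dvd_triv_right)
qed

text \<open>
  A nonempty partition with at least two part sizes has a weight divisible by 4. Those with one
  size \<open>k\<close> have weight 2 and mex 1, except that the mex is the even number 2 when \<open>k = 1\<close>.
\<close>

lemma sigma_odd_mex_cong_divisors:
  assumes n: "n > 0"
  shows "[sigma_odd_mex n = 2 * card ({k. k dvd n} - {1})] (mod 4)"
proof -
  let ?t = "\<lambda>ys. 2 ^ card (set ys) * mex_odd_parts ys"
  let ?One = "{ys \<in> partitions n. card (set ys) = 1}"
  let ?Many = "{ys \<in> partitions n. card (set ys) \<noteq> 1}"
  have "4 dvd ?t ys" if "ys \<in> ?Many" for ys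
  proof -
    have "ys \<noteq> []" using that n by (auto simp: partitions_def)
    then have "card (set ys) \<noteq> 0" by simp
    moreover have "card (set ys) \<noteq> 1" using that by simp
    ultimately have "2 \<le> card (set ys)" by linarith
    then have "(2::nat) ^ 2 dvd 2 ^ card (set ys)" by (rule le_imp_power_dvd)
    then show ?thesis by (simp add: dvd_mult2)
  qed
  then have Many: "[sum ?t ?Many = 0] (mod 4)"
    unfolding cong_0_iff by (rule dvd_sum)
  have "sum ?t ?One = (\<Sum>k | k dvd n. ?t (replicate (n div k) k))"
    by (rule sum.reindex_bij_betw[OF bij_betw_divisors_one_size_partitions[OF n], symmetric])
  also have "\<dots> = (\<Sum>k | k dvd n. if k = 1 then 0 else 2)"
  proof (rule sum.cong[OF refl])
    fix k assume "k \<in> {k. k dvd n}"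
    then have "k > 0" "n div k > 0" using n by (auto elim!: dvdE)
    then have set: "set (replicate (n div k) k) = {k}" by simp
    show "?t (replicate (n div k) k) = (if k = 1 then 0 else 2)"
      unfolding mex_odd_parts_singleton[OF set \<open>k > 0\<close>] set by simp
  qed
  also have "\<dots> = (\<Sum>k \<in> {k. k dvd n} - {1}. 2)"
    using n by (intro sum.mono_neutral_cong_right) auto
  finally have One: "sum ?t ?One = 2 * card ({k. k dvd n} - {1})"
    by simp
  have "partitions n = ?One \<union> ?Many" by blast
  then have "sigma_odd_mex n = sum ?t (?One \<union> ?Many)"
    by (simp only: sigma_odd_mex_eq_sum_partitions)
  also have "\<dots> = sum ?t ?One + sum ?t ?Many"
    by (rule sum.union_disjoint) (auto simp: finite_partitions)
  finally show ?thesis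
    using cong_add[OF cong_refl Many, of "sum ?t ?One"] One by simp
qed

text \<open>
  The involution \<open>k \<mapsto> n div k\<close> exchanges the divisors below and above the square root of \<open>n\<close>;
  only the square root itself, if it is an integer, is left unpaired.
\<close>

lemma odd_card_divisors_iff_square:
  fixes n :: nat
  assumes n: "n > 0"
  shows "odd (card {k. k dvd n}) \<longleftrightarrow> is_square n"
proof -
  let ?S = "{k. k dvd n \<and> k * k < n}"
  let ?L = "{k. k dvd n \<and> k * k > n}"
  let ?M = "{k. k dvd n \<and> k * k = n}"
  have fin: "finite {k. k dvd n}" using n by simp
  have flip: "n div k dvd n \<and> n div (n div k) = k \<and>
      (k * k < n \<longleftrightarrow> n div k * (n div k) > n) \<and> (k * k > n \<longleftrightarrow> n div k * (n div k) < n)"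
    if "k dvd n" for k
  proof -
    from that obtain m where m: "n = k * m" by (rule dvdE)
    then show ?thesis using n by auto
  qed
  have "bij_betw (\<lambda>k. n div k) ?S ?L"
    by (rule bij_betw_byWitness[where f' = "\<lambda>k. n div k"]) (use flip in blast)+
  then have SL: "card ?S = card ?L" by (rule bij_betw_same_card)
  have "{k. k dvd n} = (?S \<union> ?L) \<union> ?M" by auto
  then have "card {k. k dvd n} = card ((?S \<union> ?L) \<union> ?M)"
    by (rule arg_cong)
  also have "\<dots> = card (?S \<union> ?L) + card ?M"
    by (rule card_Un_disjoint) (auto intro: finite_subset[OF _ fin])
  also have "card (?S \<union> ?L) = card ?S + card ?L"
    by (rule card_Un_disjoint) (auto intro: finite_subset[OF _ fin])
  finally have parity: "odd (card {k. k dvd n}) \<longleftrightarrow> odd (card ?M)"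
    by (simp add: SL)
  show ?thesis
  proof (cases "is_square n")
    case True
    then obtain r where "n = r ^ 2" by (auto simp: is_nth_power_def)
    then have "k * k = n \<longleftrightarrow> k = r" for k
      using power2_eq_iff_nonneg[of k r] by (simp add: power2_eq_square)
    moreover have "?M = {k. k * k = n}" by auto
    ultimately have "?M = {r}" by (simp only: singleton_conv)
    then show ?thesis using parity True by simp
  next
    case False
    then have "?M = {}" by (auto simp: is_nth_power_def power2_eq_square)
    then have "card ?M = 0" by (simp only: card.empty)
    then show ?thesis using parity False by simp
  qed
qed

theorem theorem1p4:
  "sigma_odd_mex 0 = 1 \<and>
   (\<forall>n::nat. n \<ge> 1 \<longrightarrow> ([sigma_odd_mex n = 0] (mod 4) \<longleftrightarrow> is_square n))"
proof (intro conjI allI impI)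
  have "partitions 0 = {[]}"
    by (auto simp: partitions_def) (metis list.set_intros(1) neq_Nil_conv less_irrefl)
  moreover have "mex_odd_parts [] = 1"
  proof -
    have "(LEAST k::nat. k > 0) = 1" by (rule Least_equality) auto
    then show ?thesis by (simp add: mex_odd_parts_def)
  qed
  ultimately show "sigma_odd_mex 0 = 1"
    by (simp add: sigma_odd_mex_eq_sum_partitions)
next
  fix n :: nat assume "n \<ge> 1"
  then have n: "n > 0" by simp
  let ?c = "card ({k. k dvd n} - {1})"
  have c: "card {k. k dvd n} = Suc ?c"
    by (rule card.remove) (use n in auto)
  have "[sigma_odd_mex n = 0] (mod 4) \<longleftrightarrow> 4 dvd 2 * ?c"
    using sigma_odd_mex_cong_divisors[OF n] by (simp add: cong_0_iff cong_dvd_iff)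
  also have "\<dots> \<longleftrightarrow> even ?c" by presburger
  also have "\<dots> \<longleftrightarrow> odd (card {k. k dvd n})" unfolding c by (simp only: even_Suc not_not)
  also have "\<dots> \<longleftrightarrow> is_square n" by (rule odd_card_divisors_iff_square[OF n])
  finally show "[sigma_odd_mex n = 0] (mod 4) \<longleftrightarrow> is_square n" .
qed

end
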